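(* Let $n\ge p\ge1$. For any $C \subseteq [p]$ and $X \in \mathrm{St}(n,p)$, the submanifold block $\mathcal M_{X_{[p]\setminus C}}$ is $1$-proximally smooth. In particular, for any $\Xi \in \mathbb{R}^{n \times |C|}$ with $\mathrm{dist}(\Xi, \mathcal M_{X_{[p]\setminus C}}) < 1$, we have $$\mathcal P_{\mathcal M_{X_{[p]\setminus C}}}(\Xi) = \mathcal P_{\mathrm{St}(n,|C|)}\left(\left(I - X_{[p]\setminus C}X_{[p]\setminus C}^\top \right)\Xi\right) = \left(I - X_{[p]\setminus C}X_{[p]\setminus C}^\top \right)\Xi \left[\Xi^\top \left(I - X_{[p]\setminus C}X_{[p]\setminus C}^\top \right)\Xi\right]^{-\frac{1}{2}}.$$ If in addition $X_{[p]\setminus C}^\top \Xi = 0$, then $\mathcal P_{\mathcal M_{X_{[p]\setminus C}}}(\Xi) = \mathcal P_{\mathrm{St}(n,|C|)}(\Xi)$.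
   Context: $[p]=\{1,\dots,p\}$; $\mathrm{St}(n,q)=\{X\in\mathbb{R}^{n\times q}:X^\top X=I\}$. For $D\subseteq[p]$, $X_D\in\mathbb{R}^{n\times|D|}$ is the submatrix of $X$ formed by the columns with indices in $D$. The submanifold block at $X\in\mathrm{St}(n,p)$ with respect to $C$ is $\mathcal M_{X_{[p]\setminus C}}=\{Y\in\mathrm{St}(n,|C|):X_{[p]\setminus C}^\top Y=0\}$. With $\|\cdot\|$ the Frobenius norm, $\mathrm{dist}(\Xi,\mathcal S)=\inf_{Y\in\mathcal S}\|\Xi-Y\|$ and $\mathcal P_{\mathcal S}(\Xi)=\{Y\in\mathcal S:\|\Xi-Y\|=\mathrm{dist}(\Xi,\mathcal S)\}$ (identified with its element when it is a singleton). A closed set $\mathcal S$ is $R$-proximally smooth if $\mathcal P_{\mathcal S}(\Xi)$ is a singleton whenever $\mathrm{dist}(\Xi,\mathcal S)<R$. *)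

theory Defs
  imports
    Complex_Main
    "HOL-Library.Extended_Real"
    "Jordan_Normal_Form.DL_Submatrix"
    "Jordan_Normal_Form.Gauss_Jordan_Elimination"
begin

text \<open>
  Matrices have dimensions given by natural numbers, with zero columns allowed, so that the
  empty set of columns is covered. Columns are indexed from 0: the index set $[p]$ is
  \<open>{..<p}\<close>.
\<close>

definition frob_norm :: "real mat \<Rightarrow> real" where
  "frob_norm A = sqrt (\<Sum>i<dim_row A. \<Sum>j<dim_col A. (A $$ (i, j))\<^sup>2)"

text \<open>Extended real values give the distance to the empty set its usual value \<open>\<infinity>\<close>.\<close>

definition dist_set :: "real mat \<Rightarrow> real mat set \<Rightarrow> ereal" where
  "dist_set \<Xi> S = (INF Y\<in>S. ereal (frob_norm (\<Xi> - Y)))"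

definition proj_set :: "real mat set \<Rightarrow> real mat \<Rightarrow> real mat set" where
  "proj_set S \<Xi> = {Y \<in> S. ereal (frob_norm (\<Xi> - Y)) = dist_set \<Xi> S}"

text \<open>
  The type of all matrices carries no topology; closedness in the space of
  \<open>n \<times> q\<close> matrices is sequential closedness with respect to the Frobenius norm.
\<close>

definition closed_mats :: "nat \<Rightarrow> nat \<Rightarrow> real mat set \<Rightarrow> bool" where
  "closed_mats n q S \<longleftrightarrow> S \<subseteq> carrier_mat n q \<and>
    (\<forall>Y A. (\<forall>k::nat. Y k \<in> S) \<longrightarrow> A \<in> carrier_mat n q \<longrightarrow>
      (\<lambda>k. frob_norm (Y k - A)) \<longlonglongrightarrow> 0 \<longrightarrow> A \<in> S)"

definition proximally_smooth :: "nat \<Rightarrow> nat \<Rightarrow> real \<Rightarrow> real mat set \<Rightarrow> bool" where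
  "proximally_smooth n q R S \<longleftrightarrow> closed_mats n q S \<and>
    (\<forall>\<Xi>\<in>carrier_mat n q. dist_set \<Xi> S < ereal R \<longrightarrow> is_singleton (proj_set S \<Xi>))"

definition stiefel :: "nat \<Rightarrow> nat \<Rightarrow> real mat set" where
  "stiefel n q = {X \<in> carrier_mat n q. transpose_mat X * X = 1\<^sub>m q}"

abbreviation sub_cols :: "real mat \<Rightarrow> nat set \<Rightarrow> real mat" where
  "sub_cols X D \<equiv> submatrix X UNIV D"

definition submanifold_block :: "nat \<Rightarrow> nat \<Rightarrow> real mat \<Rightarrow> nat set \<Rightarrow> real mat set" where
  "submanifold_block n p X C = {Y \<in> stiefel n (card C).
    transpose_mat (sub_cols X ({..<p} - C)) * Y = 0\<^sub>m (card ({..<p} - C)) (card C)}"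

definition symmetric_mat :: "real mat \<Rightarrow> bool" where
  "symmetric_mat A \<longleftrightarrow> transpose_mat A = A"

definition pos_semidef :: "real mat \<Rightarrow> bool" where
  "pos_semidef A \<longleftrightarrow> symmetric_mat A \<and>
    (\<forall>v\<in>carrier_vec (dim_row A). 0 \<le> v \<bullet> (A *\<^sub>v v))"

definition pos_def :: "real mat \<Rightarrow> bool" where
  "pos_def A \<longleftrightarrow> symmetric_mat A \<and>
    (\<forall>v\<in>carrier_vec (dim_row A). v \<noteq> 0\<^sub>v (dim_row A) \<longrightarrow> 0 < v \<bullet> (A *\<^sub>v v))"

text \<open>
  The principal square root of a positive semidefinite matrix, and $A^{-1/2}$ as its inverse.
  The latter is meaningful only for positive definite \<open>A\<close>.
\<close>

definition mat_sqrt :: "real mat \<Rightarrow> real mat" where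
  "mat_sqrt A = (THE B. B \<in> carrier_mat (dim_row A) (dim_row A) \<and> pos_semidef B \<and> B * B = A)"

definition mat_inv_sqrt :: "real mat \<Rightarrow> real mat" where
  "mat_inv_sqrt A = the (mat_inverse (mat_sqrt A))"

end

theory Submission
  imports Defs "Jordan_Normal_Form.Spectral_Radius"
begin

text \<open>
  With $U = X_{[p] - C}$, the matrix $Q = I - U U^T$ is the orthogonal projector for which the
  block is the set of all $Y$ in the Stiefel manifold with $QY = Y$. By Pythagoras
  $\|\Xi - Y\|^2 = \|Q\Xi - Y\|^2 + \|\Xi - Q\Xi\|^2$ for such $Y$. If some $Y$ has distance
  less than 1 from $A = Q\Xi$, then $A$ is injective, so $S = (A^T A)^{1/2}$ is positive definite
  and $P = A S^{-1}$ is orthonormal with $QP = P$. For every orthonormal $Z$ one has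
  $\|A - Z\|^2 - \|A - P\|^2 = \langle (P - Z) S, P - Z \rangle$, which is positive unless $Z = P$;
  hence $P$ is the unique nearest point to $A$ in the Stiefel manifold and to $\Xi$ in the block.
\<close>

section \<open>Spectral theorem for real symmetric matrices\<close>

lemma scalar_prod_self_nonneg: "0 \<le> v \<bullet> (v :: real vec)"
  by (auto simp: scalar_prod_def intro: sum_nonneg)

lemma scalar_prod_self_eq_0_iff:
  assumes "(v :: real vec) \<in> carrier_vec n"
  shows "v \<bullet> v = 0 \<longleftrightarrow> v = 0\<^sub>v n"
  using assms by (auto simp: scalar_prod_def sum_nonneg_eq_0_iff vec_eq_iff)

lemma scalar_prod_mult_mat_vec_transpose:
  assumes "(A :: real mat) \<in> carrier_mat n m" "x \<in> carrier_vec n" "y \<in> carrier_vec m"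
  shows "x \<bullet> (A *\<^sub>v y) = (transpose_mat A *\<^sub>v x) \<bullet> y"
proof -
  have "x \<bullet> (A *\<^sub>v y) = (\<Sum>i<n. \<Sum>j<m. x $ i * (A $$ (i,j) * y $ j))"
    using assms by (auto simp: scalar_prod_def sum_distrib_left atLeast0LessThan intro!: sum.cong)
  also have "\<dots> = (\<Sum>j<m. \<Sum>i<n. x $ i * (A $$ (i,j) * y $ j))"
    by (rule sum.swap)
  also have "\<dots> = (transpose_mat A *\<^sub>v x) \<bullet> y"
    using assms
    by (auto simp: scalar_prod_def sum_distrib_left sum_distrib_right atLeast0LessThan mult_ac
        intro!: sum.cong)
  finally show ?thesis .
qed

text \<open>A complex eigenvector \<open>w = x + i y\<close> with eigenvalue \<open>a + i b\<close>
  always exists. By symmetry \<open>y \<bullet> (A *\<^sub>v x)\<close> and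
  \<open>(A *\<^sub>v y) \<bullet> x\<close> agree, and comparing the two expansions gives
  \<open>b * (x \<bullet> x + y \<bullet> y) = 0\<close>. So \<open>b = 0\<close>, and whichever of
  \<open>x\<close>, \<open>y\<close> is nonzero is a real eigenvector, which is then
  normalised.\<close>

lemma symmetric_real_eigenvector:
  assumes A: "(A :: real mat) \<in> carrier_mat n n" and sym: "transpose_mat A = A" and n: "n > 0"
  obtains c v where "v \<in> carrier_vec n" "v \<bullet> v = 1" "A *\<^sub>v v = c \<cdot>\<^sub>v v"
proof -
  let ?Ac = "map_mat complex_of_real A"
  have Ac: "?Ac \<in> carrier_mat n n" using A by auto
  from spectrum_non_empty[OF Ac n] obtain \<mu> w
    where w: "w \<in> carrier_vec n" "w \<noteq> 0\<^sub>v n" and ev: "?Ac *\<^sub>v w = \<mu> \<cdot>\<^sub>v w"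
    unfolding spectrum_def eigenvalue_def eigenvector_def using A by auto
  define x where "x = map_vec Re w"
  define y where "y = map_vec Im w"
  define a where "a = Re \<mu>"
  define b where "b = Im \<mu>"
  have x: "x \<in> carrier_vec n" and y: "y \<in> carrier_vec n"
    using w by (auto simp: x_def y_def)
  have comp: "(\<Sum>j<n. complex_of_real (A $$ (i,j)) * w $ j) = \<mu> * w $ i" if "i < n" for i
  proof -
    have "(?Ac *\<^sub>v w) $ i = (\<Sum>j<n. complex_of_real (A $$ (i,j)) * w $ j)"
      using that A w by (auto simp: scalar_prod_def atLeast0LessThan)
    then show ?thesis using ev that w by simp
  qed
  have Ax: "(A *\<^sub>v x) $ i = a * x $ i - b * y $ i" if "i < n" for i
    using arg_cong[OF comp[OF that], of Re] that A w
    by (auto simp: scalar_prod_def atLeast0LessThan x_def y_def a_def b_def)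
  have Ay: "(A *\<^sub>v y) $ i = b * x $ i + a * y $ i" if "i < n" for i
    using arg_cong[OF comp[OF that], of Im] that A w
    by (auto simp: scalar_prod_def atLeast0LessThan x_def y_def a_def b_def)
  have "y \<bullet> (A *\<^sub>v x) = (\<Sum>i<n. y $ i * (a * x $ i - b * y $ i))"
    using A x y Ax by (auto simp: scalar_prod_def[of y] atLeast0LessThan simp del: index_mult_mat_vec)
  also have "\<dots> = a * (\<Sum>i<n. x $ i * y $ i) - b * (\<Sum>i<n. y $ i * y $ i)"
    by (simp add: sum_distrib_left sum_subtractf algebra_simps)
  finally have 1: "y \<bullet> (A *\<^sub>v x) = a * (\<Sum>i<n. x $ i * y $ i) - b * (\<Sum>i<n. y $ i * y $ i)" .
  have "(A *\<^sub>v y) \<bullet> x = (\<Sum>i<n. (b * x $ i + a * y $ i) * x $ i)"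
    using A x y Ay by (auto simp: scalar_prod_def[of _ x] atLeast0LessThan simp del: index_mult_mat_vec)
  also have "\<dots> = b * (\<Sum>i<n. x $ i * x $ i) + a * (\<Sum>i<n. x $ i * y $ i)"
    by (simp add: sum_distrib_left sum.distrib algebra_simps)
  finally have 2: "(A *\<^sub>v y) \<bullet> x = b * (\<Sum>i<n. x $ i * x $ i) + a * (\<Sum>i<n. x $ i * y $ i)" .
  have "y \<bullet> (A *\<^sub>v x) = (A *\<^sub>v y) \<bullet> x"
    using scalar_prod_mult_mat_vec_transpose[OF A y x] sym by simp
  then have "b * (\<Sum>i<n. x $ i * x $ i) + b * (\<Sum>i<n. y $ i * y $ i) = 0"
    using 1 2 by linarith
  then have b0: "b * (x \<bullet> x + y \<bullet> y) = 0"
    using x y by (simp add: scalar_prod_def atLeast0LessThan algebra_simps)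
  have nz: "x \<noteq> 0\<^sub>v n \<or> y \<noteq> 0\<^sub>v n"
    using w by (auto simp: x_def y_def vec_eq_iff complex_eq_iff)
  then have "x \<bullet> x + y \<bullet> y \<noteq> 0"
    using scalar_prod_self_nonneg[of x] scalar_prod_self_nonneg[of y]
      scalar_prod_self_eq_0_iff[OF x] scalar_prod_self_eq_0_iff[OF y] by linarith
  with b0 have "b = 0" by simp
  then have "A *\<^sub>v x = a \<cdot>\<^sub>v x" "A *\<^sub>v y = a \<cdot>\<^sub>v y"
    using Ax Ay A x y by (auto simp: vec_eq_iff simp del: index_mult_mat_vec)
  with nz x y obtain z where z: "z \<in> carrier_vec n" "z \<noteq> 0\<^sub>v n" "A *\<^sub>v z = a \<cdot>\<^sub>v z"
    by blast
  define k where "k = 1 / sqrt (z \<bullet> z)"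
  have zz: "z \<bullet> z > 0"
    using scalar_prod_self_nonneg[of z] scalar_prod_self_eq_0_iff[OF z(1)] z(2) by linarith
  show ?thesis
  proof
    show "k \<cdot>\<^sub>v z \<in> carrier_vec n" using z by simp
    show "(k \<cdot>\<^sub>v z) \<bullet> (k \<cdot>\<^sub>v z) = 1" using zz z by (simp add: k_def)
    show "A *\<^sub>v (k \<cdot>\<^sub>v z) = a \<cdot>\<^sub>v (k \<cdot>\<^sub>v z)"
      using A z by (simp add: mult_mat_vec smult_smult_assoc mult.commute)
  qed
qed

lemma reflection_to_unit_vec:
  assumes v: "(v :: real vec) \<in> carrier_vec n" "v \<bullet> v = 1" and n: "n > 0"
  obtains H where "H \<in> carrier_mat n n" "transpose_mat H = H" "H * H = 1\<^sub>m n"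
    "H *\<^sub>v unit_vec n 0 = v"
proof -
  \<comment> \<open>The Householder reflection along \<open>v - e\<^sub>0\<close>; if \<open>v = e\<^sub>0\<close> then \<open>2 / 0 = 0\<close> makes it the identity.\<close>
  define u where "u i = v $ i - (if i = 0 then 1 else 0)" for i
  define s where "s = (\<Sum>i<n. u i * u i)"
  define c where "c = 2 / s"
  define H where "H = mat n n (\<lambda>(i,j). (if i = j then 1 else 0) - c * u i * u j)"
  \<comment> \<open>This cancels the quadratic term of \<open>H * H\<close> against its linear
    terms; it also holds for \<open>s = 0\<close>, where \<open>c = 0\<close>.\<close>
  have ccs: "c * c * s = 2 * c" by (simp add: c_def)
  have vv: "(\<Sum>i<n. v $ i * v $ i) = 1" using v by (simp add: scalar_prod_def atLeast0LessThan)
  \<comment> \<open>Only the summand at index 0 differs from that of \<open>v \<bullet> v\<close>,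
    and there by \<open>2 * v $ 0 - 1\<close>.\<close>
  have "s = (\<Sum>i<n. v $ i * v $ i - (if i = 0 then 2 * v $ 0 - 1 else 0))"
    unfolding s_def u_def by (rule sum.cong) (auto simp: algebra_simps)
  then have s: "s = 2 - 2 * v $ 0"
    using n vv by (simp add: sum_subtractf)
  have s0: "u i = 0" if "s = 0" "i < n" for i
    using that unfolding s_def by (auto simp: sum_nonneg_eq_0_iff)
  \<comment> \<open>Since \<open>s = - 2 * u 0\<close>, the factor \<open>c * u 0\<close> is -1; if
    \<open>s = 0\<close>, both sides vanish. It follows that column 0 of \<open>H\<close> is
    \<open>v\<close>.\<close>
  have cu0: "c * u 0 * u i = - u i" if "i < n" for i
  proof (cases "s = 0")
    case False
    then show ?thesis by (simp add: c_def u_def s field_simps)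
  qed (use that s0 in auto)
  show ?thesis
  proof
    show H: "H \<in> carrier_mat n n" by (simp add: H_def)
    show "transpose_mat H = H" by (rule eq_matI) (auto simp: H_def)
    show "H * H = 1\<^sub>m n"
    proof (rule eq_matI)
      fix i j assume "i < dim_row (1\<^sub>m n)" "j < dim_col (1\<^sub>m n)"
      then have ij: "i < n" "j < n" by auto
      have "(H * H) $$ (i,j) = (\<Sum>k<n. ((if i = k then 1 else 0) - c * u i * u k) *
          ((if k = j then 1 else 0) - c * u k * u j))"
        using ij by (simp add: H_def scalar_prod_def atLeast0LessThan)
      also have "\<dots> = (\<Sum>k<n. (if k = i then (if i = j then 1 else 0) - c * u i * u j else 0)
          - (if k = j then c * u i * u j else 0) + c * c * u i * u j * (u k * u k))"
        by (rule sum.cong) (auto simp: algebra_simps)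
      also have "\<dots> = (if i = j then 1 else 0) - 2 * c * u i * u j + c * c * s * u i * u j"
        using ij by (simp add: sum.distrib sum_subtractf s_def sum_distrib_left mult_ac)
      also have "\<dots> = 1\<^sub>m n $$ (i,j)" using ij ccs by simp
      finally show "(H * H) $$ (i,j) = 1\<^sub>m n $$ (i,j)" .
    qed (auto simp: H_def)
    show "H *\<^sub>v unit_vec n 0 = v"
    proof (rule eq_vecI)
      fix i assume "i < dim_vec v"
      then have i: "i < n" using v by auto
      have "(H *\<^sub>v unit_vec n 0) $ i = H $$ (i, 0)"
        using H n i by simp
      also have "\<dots> = v $ i" using i n cu0[OF i] by (simp add: H_def u_def mult_ac)
      finally show "(H *\<^sub>v unit_vec n 0) $ i = v $ i" .
    qed (use H v in auto)
  qed
qed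

text \<open>Deflation. A symmetric orthogonal \<open>H\<close> takes the first unit vector to an
  eigenvector of \<open>A\<close>, so column 0 of \<open>M = H * A * H\<close> is zero below its
  first entry \<open>c\<close>, and by symmetry so is row 0 to its right. The remaining block
  \<open>B\<close> is symmetric and is diagonalised by induction; bordering its \<open>P\<close>
  with a 1 gives \<open>R\<close>, and \<open>H * R\<close> diagonalises \<open>A\<close>.\<close>

lemma real_symmetric_spectral:
  assumes "(A :: real mat) \<in> carrier_mat n n" and "transpose_mat A = A"
  shows "\<exists>P d. P \<in> carrier_mat n n \<and> transpose_mat P * P = 1\<^sub>m n \<and>
    A = P * mat_diag n d * transpose_mat P"
  using assms
proof (induction n arbitrary: A)
  case 0
  show ?case
  proof (intro exI conjI)
    show "1\<^sub>m 0 \<in> carrier_mat 0 0" by simp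
    show "transpose_mat (1\<^sub>m 0) * 1\<^sub>m 0 = 1\<^sub>m 0" by (rule eq_matI) auto
    show "A = 1\<^sub>m 0 * mat_diag 0 (\<lambda>_. 0) * transpose_mat (1\<^sub>m 0)"
      using "0.prems" by auto
  qed
next
  case (Suc n)
  note A = Suc.prems(1) and sym = Suc.prems(2)
  obtain c v where v: "v \<in> carrier_vec (Suc n)" "v \<bullet> v = 1" "A *\<^sub>v v = c \<cdot>\<^sub>v v"
    using symmetric_real_eigenvector[OF A sym] by blast
  let ?e = "unit_vec (Suc n) 0 :: real vec"
  obtain H where H: "H \<in> carrier_mat (Suc n) (Suc n)" "transpose_mat H = H"
    "H * H = 1\<^sub>m (Suc n)" "H *\<^sub>v ?e = v"
    using reflection_to_unit_vec[OF v(1,2)] by blast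
  define M where "M = H * A * H"
  have M: "M \<in> carrier_mat (Suc n) (Suc n)" using A H by (simp add: M_def)
  have Hv: "H *\<^sub>v v = ?e"
    unfolding H(4)[symmetric] using H(1,3) by (simp flip: assoc_mult_mat_vec)
  have "M *\<^sub>v ?e = H *\<^sub>v (A *\<^sub>v (H *\<^sub>v ?e))"
    unfolding M_def using A H(1) by (simp add: assoc_mult_mat_vec[of _ "Suc n" "Suc n" _ "Suc n"])
  also have "\<dots> = c \<cdot>\<^sub>v ?e" using v H(1) by (simp add: H(4) Hv mult_mat_vec)
  finally have Me: "M *\<^sub>v ?e = c \<cdot>\<^sub>v ?e" .
  have col: "M $$ (i, 0) = (if i = 0 then c else 0)" if "i < Suc n" for i
    using arg_cong[OF Me, of "\<lambda>u. u $ i"] that M by (auto split: if_splits)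
  have Msym: "transpose_mat M = M"
    unfolding M_def using A H(1) by (simp add: transpose_mult[of _ "Suc n" "Suc n" _ "Suc n"] sym H(2))
  have row: "M $$ (0, i) = (if i = 0 then c else 0)" if "i < Suc n" for i
    using col[OF that] that M arg_cong[OF Msym, of "\<lambda>B. B $$ (0, i)"] by simp
  define B where "B = mat n n (\<lambda>(i,j). M $$ (Suc i, Suc j))"
  have B: "B \<in> carrier_mat n n" by (simp add: B_def)
  have "transpose_mat B = B"
  proof (rule eq_matI)
    fix i j assume "i < dim_row B" "j < dim_col B"
    then have ij: "i < n" "j < n" using B by auto
    then show "transpose_mat B $$ (i, j) = B $$ (i, j)"
      using arg_cong[OF Msym, of "\<lambda>B. B $$ (Suc i, Suc j)"] M by (simp add: B_def)
  qed (use B in auto)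
  from Suc.IH[OF B this] obtain P d where P: "P \<in> carrier_mat n n" "transpose_mat P * P = 1\<^sub>m n"
    and BP: "B = P * mat_diag n d * transpose_mat P" by blast
  let ?z = "0\<^sub>m 1 n :: real mat" and ?z' = "0\<^sub>m n 1 :: real mat"
  define R where "R = four_block_mat (1\<^sub>m 1) ?z ?z' P"
  define D where "D = four_block_mat (mat 1 1 (\<lambda>_. c)) ?z ?z' (mat_diag n d)"
  \<comment> \<open>The new eigenvalue takes index 0, so the eigenvalues of \<open>B\<close> move up
    by one.\<close>
  define f where "f i = (if i = 0 then c else d (i - 1))" for i
  have RT: "transpose_mat R = four_block_mat (1\<^sub>m 1) ?z ?z' (transpose_mat P)"
    unfolding R_def using P by (subst transpose_four_block_mat[of _ 1 1 _ n _ n]) auto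
  have R: "R \<in> carrier_mat (Suc n) (Suc n)" unfolding R_def using P
    by (metis One_nat_def four_block_carrier_mat one_carrier_mat plus_1_eq_Suc)
  have D: "D = mat_diag (Suc n) f"
    by (rule eq_matI) (auto simp: D_def f_def mat_diag_def)
  have RR: "transpose_mat R * R = 1\<^sub>m (Suc n)"
    unfolding RT unfolding R_def using P
    by (subst mult_four_block_mat[of _ 1 1 _ n _ n _ _ 1 _ n]) auto
  \<comment> \<open>The laws for zero blocks are restated with \<open>Suc 0\<close>, the form into
    which the simplifier brings the dimension 1.\<close>
  have z: "0\<^sub>m (Suc 0) n * X = 0\<^sub>m (Suc 0) n" if "X \<in> carrier_mat n n" for X :: "real mat"
    using that by (rule left_mult_zero_mat)
  have z': "X * 0\<^sub>m n (Suc 0) = 0\<^sub>m n (Suc 0)" if "X \<in> carrier_mat n n" for X :: "real mat"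
    using that by (rule right_mult_zero_mat)
  have BP': "P * mat_diag n d * transpose_mat P \<in> carrier_mat n n" using B unfolding BP .
  have "R * D = four_block_mat (mat 1 1 (\<lambda>_. c)) ?z ?z' (P * mat_diag n d)"
    unfolding R_def D_def using P
    by (subst mult_four_block_mat[of _ 1 1 _ n _ n _ _ 1 _ n]) (auto simp: z z' left_add_zero_mat[OF BP'])
  then have "R * D * transpose_mat R = four_block_mat (mat 1 1 (\<lambda>_. c)) ?z ?z' B"
    unfolding RT BP using P
    by (simp, subst mult_four_block_mat[of _ 1 1 _ n _ n _ _ 1 _ n]) (auto simp: z z' left_add_zero_mat[OF BP'])
  also have "\<dots> = M"
  proof (rule eq_matI)
    fix i j assume ij: "i < dim_row M" "j < dim_col M"
    then show "four_block_mat (mat 1 1 (\<lambda>_. c)) ?z ?z' B $$ (i, j) = M $$ (i, j)"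
      using M B col[of i] row[of j] by (cases i; cases j) (auto simp: B_def)
  qed (use M B in auto)
  finally have MR: "R * D * transpose_mat R = M" .
  have HH: "H * (H * X) = X" if "X \<in> carrier_mat (Suc n) (Suc n)" for X
    using H that by (simp flip: assoc_mult_mat[of H "Suc n" "Suc n" H "Suc n" X])
  have Dc: "D \<in> carrier_mat (Suc n) (Suc n)" using D by simp
  have HR: "transpose_mat (H * R) = transpose_mat R * H"
    using H R by (simp add: transpose_mult[of _ "Suc n" "Suc n" _ "Suc n"])
  have assoc: "X * Y * Z = X * (Y * Z)"
    if "X \<in> carrier_mat (Suc n) (Suc n)" "Y \<in> carrier_mat (Suc n) (Suc n)"
      "Z \<in> carrier_mat (Suc n) (Suc n)" for X Y Z :: "real mat"
    using that by simp
  have A_eq: "A = H * M * H"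
    unfolding M_def using A H by (simp add: assoc HH)
  show ?case
  proof (intro exI conjI)
    show "H * R \<in> carrier_mat (Suc n) (Suc n)" using H R by simp
    have "transpose_mat (H * R) * (H * R) = transpose_mat R * (H * (H * R))"
      unfolding HR using H R by (simp add: assoc)
    then show "transpose_mat (H * R) * (H * R) = 1\<^sub>m (Suc n)"
      using HH[OF R] RR by simp
    show "A = H * R * mat_diag (Suc n) f * transpose_mat (H * R)"
      unfolding HR D[symmetric] A_eq MR[symmetric] using H R Dc by (simp add: assoc)
  qed
qed

section \<open>Square roots of positive definite matrices\<close>

text \<open>In an orthonormal eigenbasis, take the square roots of the eigenvalues. The explicit
  inverse \<open>R\<close> comes along so that \<open>mat_inverse\<close> can be evaluated
  later.\<close>

lemma pos_def_sqrt_exists: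
  assumes G: "G \<in> carrier_mat n n" and pd: "pos_def G"
  obtains S R where "S \<in> carrier_mat n n" "R \<in> carrier_mat n n" "pos_def S" "S * S = G"
    "S * R = 1\<^sub>m n" "R * S = 1\<^sub>m n"
proof -
  have "transpose_mat G = G" using pd by (simp add: pos_def_def symmetric_mat_def)
  from real_symmetric_spectral[OF G this] obtain P d where P: "P \<in> carrier_mat n n"
    and PP: "transpose_mat P * P = 1\<^sub>m n" and GP: "G = P * mat_diag n d * transpose_mat P"
    by blast
  let ?T = "transpose_mat P"
  have T: "?T \<in> carrier_mat n n" using P by simp
  have PT: "P * ?T = 1\<^sub>m n" using mat_mult_left_right_inverse[OF T P PP] .
  have assoc: "X * Y * Z = X * (Y * Z)"
    if "X \<in> carrier_mat n n" "Y \<in> carrier_mat n n" "Z \<in> carrier_mat n n" for X Y Z :: "real mat"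
    using that by simp
  have mc: "X * Y \<in> carrier_mat n n" if "X \<in> carrier_mat n n" "Y \<in> carrier_mat n n"
    for X Y :: "real mat"
    using that by simp
  have TP: "?T * (P * X) = X" if "X \<in> carrier_mat n n" for X
    using that P PP by (simp flip: assoc)
  \<comment> \<open>Functional calculus for \<open>G\<close>: \<open>F\<close> turns pointwise
    products of functions on the spectrum into matrix products, \<open>F d\<close> is
    \<open>G\<close>, and the constant 1 goes to the identity. The root and its inverse then come
    from \<open>sqrt\<close> and its reciprocal.\<close>
  define F where "F g = P * mat_diag n g * ?T" for g
  have F: "F g \<in> carrier_mat n n" for g
    unfolding F_def using P by (simp add: mc)
  have Fmult: "F g * F h = F (\<lambda>i. g i * h i)" for g h
  proof -
    have "F g * F h = P * (mat_diag n g * (mat_diag n h * ?T))"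
      unfolding F_def using P by (simp add: assoc mc TP)
    also have "\<dots> = P * (mat_diag n (\<lambda>i. g i * h i) * ?T)"
      using assoc[of "mat_diag n g" "mat_diag n h" ?T] T by simp
    finally show ?thesis unfolding F_def using P by (simp add: assoc mc)
  qed
  have F1: "F (\<lambda>_. 1) = 1\<^sub>m n" using P PT by (simp add: F_def)
  have Fcong: "F g = F h" if "\<And>i. i < n \<Longrightarrow> g i = h i" for g h
  proof -
    have "mat_diag n g = mat_diag n h" using that by (auto simp: mat_diag_def)
    then show ?thesis by (simp add: F_def)
  qed
  \<comment> \<open>In the coordinates \<open>?T *\<^sub>v v\<close> the form is diagonal, so its
    sign is governed by the values of \<open>g\<close>.\<close>
  have quad: "v \<bullet> (F g *\<^sub>v v) = (\<Sum>i<n. g i * ((?T *\<^sub>v v) $ i)\<^sup>2)"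
    if v: "v \<in> carrier_vec n" for v g
  proof -
    have Tv: "?T *\<^sub>v v \<in> carrier_vec n" using T v by simp
    have "F g *\<^sub>v v = P *\<^sub>v (mat_diag n g *\<^sub>v (?T *\<^sub>v v))"
      unfolding F_def using P v by (simp add: assoc_mult_mat_vec[of _ n n _ n])
    then have "v \<bullet> (F g *\<^sub>v v) = (?T *\<^sub>v v) \<bullet> (mat_diag n g *\<^sub>v (?T *\<^sub>v v))"
      using scalar_prod_mult_mat_vec_transpose[OF P v mult_mat_vec_carrier[OF mat_diag_dim Tv]] by simp
    also have "\<dots> = (\<Sum>i<n. (?T *\<^sub>v v) $ i * (mat_diag n g *\<^sub>v (?T *\<^sub>v v)) $ i)"
      unfolding scalar_prod_def[of _ "mat_diag n g *\<^sub>v (?T *\<^sub>v v)"]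
      by (simp add: atLeast0LessThan carrier_matD[OF mat_diag_dim] del: index_mult_mat_vec)
    also have "\<dots> = (\<Sum>i<n. g i * ((?T *\<^sub>v v) $ i)\<^sup>2)"
    proof (rule sum.cong)
      fix i assume "i \<in> {..<n}"
      then have i: "i < n" by simp
      have "(mat_diag n g *\<^sub>v (?T *\<^sub>v v)) $ i =
          (\<Sum>j<n. (if i = j then g j else 0) * (?T *\<^sub>v v) $ j)"
        using i P v by (simp add: mat_diag_def scalar_prod_def[of _ "?T *\<^sub>v v"] atLeast0LessThan)
      also have "\<dots> = g i * (?T *\<^sub>v v) $ i"
        using i by (simp add: if_distrib[of "\<lambda>x. x * _"] cong: if_cong)
      finally show "(?T *\<^sub>v v) $ i * (mat_diag n g *\<^sub>v (?T *\<^sub>v v)) $ i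
          = g i * ((?T *\<^sub>v v) $ i)\<^sup>2" by (simp add: power2_eq_square mult_ac)
    qed simp
    finally show ?thesis .
  qed
  have d: "d i > 0" if i: "i < n" for i
  proof -
    have v: "col P i \<in> carrier_vec n" using P i by simp
    \<comment> \<open>Column \<open>i\<close> of \<open>P\<close> has the unit vector
      \<open>i\<close> as coordinates, so the form of \<open>G\<close> takes the value
      \<open>d i\<close> there.\<close>
    have Tv: "(?T *\<^sub>v col P i) $ j = (if j = i then 1 else 0)" if j: "j < n" for j
      using arg_cong[OF PP, of "\<lambda>M. M $$ (j, i)"] P i j by simp
    have "col P i \<noteq> 0\<^sub>v n"
    proof
      assume "col P i = 0\<^sub>v n"
      then have "(?T *\<^sub>v col P i) $ i = 0" using P i by simp
      then show False using Tv[OF i] by simp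
    qed
    then have "0 < col P i \<bullet> (G *\<^sub>v col P i)" using pd G v by (auto simp: pos_def_def)
    also have "\<dots> = (\<Sum>j<n. d j * ((?T *\<^sub>v col P i) $ j)\<^sup>2)"
      using quad[OF v, of d] by (simp add: GP F_def)
    also have "\<dots> = (\<Sum>j<n. if j = i then d j else 0)"
      by (rule sum.cong) (auto simp: Tv simp del: index_mult_mat_vec)
    also have "\<dots> = d i" using i by simp
    finally show ?thesis .
  qed
  show ?thesis
  proof
    let ?s = "\<lambda>i. sqrt (d i)" and ?r = "\<lambda>i. 1 / sqrt (d i)"
    show "F ?s \<in> carrier_mat n n" "F ?r \<in> carrier_mat n n" by (rule F)+
    have dg: "F ?s * F ?s = F d" unfolding Fmult
      using d by (intro Fcong) (simp add: less_imp_le)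
    then show "F ?s * F ?s = G" unfolding GP by (simp add: F_def)
    show "F ?s * F ?r = 1\<^sub>m n" "F ?r * F ?s = 1\<^sub>m n"
      unfolding Fmult F1[symmetric] by (intro Fcong; use d in force)+
    show "pos_def (F ?s)"
      unfolding pos_def_def symmetric_mat_def
    proof (intro conjI ballI impI)
      have "transpose_mat (mat_diag n g) = mat_diag n g" for g :: "nat \<Rightarrow> real"
        by (rule eq_matI) (auto simp: mat_diag_def)
      then show "transpose_mat (F ?s) = F ?s"
        unfolding F_def using P by (simp add: transpose_mult[of _ n n _ n] assoc mc)
      fix v :: "real vec"
      assume "v \<in> carrier_vec (dim_row (F ?s))" "v \<noteq> 0\<^sub>v (dim_row (F ?s))"
      then have v: "v \<in> carrier_vec n" "v \<noteq> 0\<^sub>v n" using F[of ?s] by auto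
      \<comment> \<open>A nonzero \<open>v\<close> has nonzero coordinates because \<open>P\<close>
        recovers it from them.\<close>
      have "P *\<^sub>v (?T *\<^sub>v v) = v" using P v PT by (simp flip: assoc_mult_mat_vec)
      moreover have "P *\<^sub>v 0\<^sub>v n = 0\<^sub>v n" using P by (intro eq_vecI) auto
      ultimately have "?T *\<^sub>v v \<noteq> 0\<^sub>v n" using v by auto
      then obtain i where i: "i < n" "(?T *\<^sub>v v) $ i \<noteq> 0"
        using P by (auto simp: vec_eq_iff simp del: index_mult_mat_vec)
      have "0 < (\<Sum>i<n. ?s i * ((?T *\<^sub>v v) $ i)\<^sup>2)"
        using i d by (intro sum_pos2[of _ i]) (auto simp: less_imp_le simp del: index_mult_mat_vec)
      then show "0 < v \<bullet> (F ?s *\<^sub>v v)" unfolding quad[OF v(1)] .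
    qed
  qed
qed

section \<open>The Frobenius inner product, that is, the trace of
  \<open>transpose_mat A * B\<close>\<close>

definition frob_inner :: "real mat \<Rightarrow> real mat \<Rightarrow> real" where
  "frob_inner A B = (\<Sum>i<dim_row A. \<Sum>j<dim_col A. A $$ (i, j) * B $$ (i, j))"

lemma frob_inner_self_nonneg: "0 \<le> frob_inner A A"
  by (auto simp: frob_inner_def intro!: sum_nonneg)

lemma frob_norm_power2: "(frob_norm A)\<^sup>2 = frob_inner A A"
  using frob_inner_self_nonneg[of A]
  by (simp add: frob_norm_def frob_inner_def power2_eq_square)

lemma frob_inner_commute:
  "A \<in> carrier_mat n m \<Longrightarrow> B \<in> carrier_mat n m \<Longrightarrow> frob_inner A B = frob_inner B A"
  by (simp add: frob_inner_def mult.commute)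

lemma frob_inner_add_left:
  "A \<in> carrier_mat n m \<Longrightarrow> B \<in> carrier_mat n m \<Longrightarrow>
    frob_inner (A + B) C = frob_inner A C + frob_inner B C"
  by (simp add: frob_inner_def sum.distrib algebra_simps)

lemma frob_inner_diff_left:
  "A \<in> carrier_mat n m \<Longrightarrow> B \<in> carrier_mat n m \<Longrightarrow>
    frob_inner (A - B) C = frob_inner A C - frob_inner B C"
  by (simp add: frob_inner_def sum_subtractf algebra_simps)

lemma frob_inner_diff_right:
  "A \<in> carrier_mat n m \<Longrightarrow> B \<in> carrier_mat n m \<Longrightarrow> C \<in> carrier_mat n m \<Longrightarrow>
    frob_inner A (B - C) = frob_inner A B - frob_inner A C"
  by (simp add: frob_inner_def sum_subtractf algebra_simps)

lemma frob_inner_transpose: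
  assumes "A \<in> carrier_mat n m" "B \<in> carrier_mat n m"
  shows "frob_inner (transpose_mat A) (transpose_mat B) = frob_inner A B"
  using assms by (simp add: frob_inner_def, subst sum.swap) simp

text \<open>Moving a factor across the inner product is what later brings
  \<open>transpose_mat Z * Z = 1\<^sub>m q\<close> into play and lets a symmetric projector be
  absorbed by a matrix that it fixes.\<close>

lemma frob_inner_mult_left:
  assumes "A \<in> carrier_mat n k" "B \<in> carrier_mat k m" "C \<in> carrier_mat n m"
  shows "frob_inner (A * B) C = frob_inner B (transpose_mat A * C)"
proof -
  have "frob_inner (A * B) C = (\<Sum>i<n. \<Sum>j<m. \<Sum>l<k. A $$ (i,l) * B $$ (l,j) * C $$ (i,j))"
    using assms by (simp add: frob_inner_def scalar_prod_def atLeast0LessThan sum_distrib_right)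
  also have "\<dots> = (\<Sum>i<n. \<Sum>l<k. \<Sum>j<m. A $$ (i,l) * B $$ (l,j) * C $$ (i,j))"
    by (intro sum.cong refl sum.swap)
  also have "\<dots> = (\<Sum>l<k. \<Sum>i<n. \<Sum>j<m. A $$ (i,l) * B $$ (l,j) * C $$ (i,j))"
    by (rule sum.swap)
  also have "\<dots> = (\<Sum>l<k. \<Sum>j<m. \<Sum>i<n. A $$ (i,l) * B $$ (l,j) * C $$ (i,j))"
    by (intro sum.cong refl sum.swap)
  also have "\<dots> = frob_inner B (transpose_mat A * C)"
    using assms by (simp add: frob_inner_def scalar_prod_def atLeast0LessThan sum_distrib_left mult_ac)
  finally show ?thesis .
qed

text \<open>The inner product is the sum, over the rows of \<open>M\<close>, of the quadratic form
  of \<open>S\<close>, and a nonzero matrix has a nonzero row. Both the uniqueness of square roots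
  and that of nearest points rest on this.\<close>

lemma pos_def_frob_inner_pos:
  assumes S: "S \<in> carrier_mat q q" "pos_def S" and M: "M \<in> carrier_mat n q" "M \<noteq> 0\<^sub>m n q"
  shows "0 < frob_inner (M * S) M"
proof -
  have row: "row M i \<bullet> (S *\<^sub>v row M i) = (\<Sum>j<q. (M * S) $$ (i,j) * M $$ (i,j))" if "i < n" for i
  proof -
    \<comment> \<open>Row \<open>i\<close> of \<open>M * S\<close> contracts the first index of
      \<open>S\<close>, whereas \<open>S *\<^sub>v row M i\<close> contracts the second.\<close>
    have "S $$ (j, l) = S $$ (l, j)" if "j < q" "l < q" for j l
      using S that by (metis carrier_matD index_transpose_mat(1) pos_def_def symmetric_mat_def)
    then show ?thesis
      using S(1) M(1) \<open>i < n\<close>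
      by (auto simp: scalar_prod_def atLeast0LessThan mult_ac intro!: sum.cong)
  qed
  have eq: "frob_inner (M * S) M = (\<Sum>i<n. row M i \<bullet> (S *\<^sub>v row M i))"
    using S(1) M(1) by (auto simp: frob_inner_def row simp del: index_mult_mat(1))
  have pos: "0 < row M i \<bullet> (S *\<^sub>v row M i)" if "i < n" "row M i \<noteq> 0\<^sub>v q" for i
    using S M that by (auto simp: pos_def_def)
  have nonneg: "0 \<le> row M i \<bullet> (S *\<^sub>v row M i)" if "i < n" for i
    using pos[OF that] S M by (cases "row M i = 0\<^sub>v q") auto
  obtain i j where ij: "i < n" "j < q" "M $$ (i,j) \<noteq> 0" using M by (auto simp: mat_eq_iff)
  then have "row M i $ j \<noteq> 0" using M by simp
  then have "row M i \<noteq> 0\<^sub>v q" using ij by auto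
  then show ?thesis unfolding eq using ij pos nonneg
    by (intro sum_pos2[of _ i]) auto
qed

section \<open>Uniqueness of the principal square root, and evaluation of \<open>mat_sqrt\<close>
  and \<open>mat_inverse\<close>\<close>

lemma pos_semidef_sqrt_unique:
  assumes S: "S \<in> carrier_mat n n" "pos_def S" and B: "B \<in> carrier_mat n n" "pos_semidef B"
    and eq: "B * B = S * S"
  shows "B = S"
proof (rule ccontr)
  assume "B \<noteq> S"
  \<comment> \<open>\<open>D T + T D = 2 (B\<^sup>2 - S\<^sup>2) = 0\<close>, whereas \<open>\<langle>D T + T D, D\<rangle> = 2 \<langle>D T, D\<rangle> > 0\<close> as \<open>T\<close> is positive definite.\<close>
  define D where "D = B - S"
  define T where "T = B + S"
  have D: "D \<in> carrier_mat n n" and T: "T \<in> carrier_mat n n" using S B by (auto simp: D_def T_def)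
  have sym: "transpose_mat S = S" "transpose_mat B = B"
    using S B by (auto simp: pos_def_def pos_semidef_def symmetric_mat_def)
  have Ts: "transpose_mat T = T" and Ds: "transpose_mat D = D"
    using S B sym by (simp_all add: T_def D_def transpose_add[of _ n n] transpose_minus[of _ n n])
  have pdT: "pos_def T"
    unfolding pos_def_def symmetric_mat_def
  proof (intro conjI ballI impI Ts)
    fix v :: "real vec"
    assume "v \<in> carrier_vec (dim_row T)" "v \<noteq> 0\<^sub>v (dim_row T)"
    then have v: "v \<in> carrier_vec n" "v \<noteq> 0\<^sub>v n" using T by auto
    then have "0 \<le> v \<bullet> (B *\<^sub>v v)" "0 < v \<bullet> (S *\<^sub>v v)"
      using S B by (auto simp: pos_def_def pos_semidef_def)
    then show "0 < v \<bullet> (T *\<^sub>v v)"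
      using v S B by (simp add: T_def add_mult_distrib_mat_vec[of _ n n] scalar_prod_add_distrib[of _ n])
  qed
  have "D \<noteq> 0\<^sub>m n n" using \<open>B \<noteq> S\<close> S B by (auto simp: D_def mat_eq_iff)
  then have pos: "0 < frob_inner (D * T) D" using pos_def_frob_inner_pos[OF T pdT D] by blast
  have dt: "D * T = B * B + B * S - (S * B + S * S)"
    unfolding D_def T_def using S B
    by (simp add: minus_mult_distrib_mat[of _ n n _ _ n] mult_add_distrib_mat[of _ n n _ n])
  have td: "T * D = B * B + S * B - (B * S + S * S)"
    unfolding D_def T_def using S B
    by (simp add: add_mult_distrib_mat[of _ n n _ _ n] mult_minus_distrib_mat[of _ n n _ n])
  have "D * T + T * D = 0\<^sub>m n n"
    unfolding dt td eq by (rule eq_matI) (use S B in \<open>auto simp del: index_mult_mat(1)\<close>)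
  moreover have "frob_inner (D * T + T * D) D = frob_inner (D * T) D + frob_inner (T * D) D"
    using D T by (intro frob_inner_add_left[of _ n n]) auto
  \<comment> \<open>Transposition preserves the inner product and, \<open>D\<close> and
    \<open>T\<close> being symmetric, exchanges \<open>D * T\<close> and
    \<open>T * D\<close>.\<close>
  moreover have "frob_inner (T * D) D = frob_inner (D * T) D"
    using frob_inner_transpose[of "D * T" n n D] D T
    by (simp add: transpose_mult[of _ n n _ n] Ts Ds)
  moreover have "frob_inner (0\<^sub>m n n) D = 0" by (simp add: frob_inner_def)
  ultimately show False using pos by simp
qed

lemma pos_def_imp_pos_semidef: "pos_def A \<Longrightarrow> pos_semidef A"
  unfolding pos_def_def pos_semidef_def
proof (intro conjI ballI; elim conjE)
  fix v :: "real vec"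
  assume sym: "symmetric_mat A" and v: "v \<in> carrier_vec (dim_row A)"
    and pos: "\<forall>v\<in>carrier_vec (dim_row A). v \<noteq> 0\<^sub>v (dim_row A) \<longrightarrow> 0 < v \<bullet> (A *\<^sub>v v)"
  show "0 \<le> v \<bullet> (A *\<^sub>v v)"
  proof (cases "v = 0\<^sub>v (dim_row A)")
    case True
    then show ?thesis by (simp add: scalar_prod_def)
  qed (use v pos in force)
qed

text \<open>The description in \<open>mat_sqrt\<close> ranges over positive semidefinite roots, so a
  positive definite root has to be compared with competitors that are only semidefinite.\<close>

lemma mat_sqrt_eqI:
  assumes "S \<in> carrier_mat n n" "pos_def S" "S * S = G"
  shows "mat_sqrt G = S"
  unfolding mat_sqrt_def
proof (rule the_equality)
  have "dim_row G = n" using assms by auto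
  then show "S \<in> carrier_mat (dim_row G) (dim_row G) \<and> pos_semidef S \<and> S * S = G"
    using assms pos_def_imp_pos_semidef by auto
  show "B = S" if "B \<in> carrier_mat (dim_row G) (dim_row G) \<and> pos_semidef B \<and> B * B = G" for B
    using that assms pos_semidef_sqrt_unique \<open>dim_row G = n\<close> by auto
qed

lemma mat_inverse_eqI:
  assumes S: "S \<in> carrier_mat n n" and R: "R \<in> carrier_mat n n" "S * R = 1\<^sub>m n" "R * S = 1\<^sub>m n"
  shows "mat_inverse S = Some (R :: real mat)"
proof (cases "mat_inverse S")
  case None
  have "S \<in> Units (ring_mat TYPE(real) n n)"
    using S R by (auto simp: Units_def ring_mat_def)
  with mat_inverse(1)[OF S None, of n] show ?thesis by blast
next
  case (Some B)
  note B = mat_inverse(2)[OF S Some]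
  have "B = B * (S * R)" using right_mult_one_mat[of B n n] B R(2) by simp
  also have "\<dots> = B * S * R" by (rule assoc_mult_mat[symmetric]) (use B S R in auto)
  also have "\<dots> = R" using left_mult_one_mat[of R n n] B R(1) by simp
  finally show ?thesis using Some by simp
qed

section \<open>Nearest points on the Stiefel manifold\<close>

lemma frob_norm_nonneg: "0 \<le> frob_norm A"
  by (simp add: frob_norm_def sum_nonneg)

lemma frob_norm_less_iff: "frob_norm A < frob_norm B \<longleftrightarrow> (frob_norm A)\<^sup>2 < (frob_norm B)\<^sup>2"
  using frob_norm_nonneg by (metis power2_less_imp_less power_strict_mono zero_less_numeral)

lemma frob_norm_diff_power2:
  assumes "A \<in> carrier_mat n q" "B \<in> carrier_mat n q"
  shows "(frob_norm (A - B))\<^sup>2 = frob_inner A A - 2 * frob_inner A B + frob_inner B B"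
proof -
  have "frob_inner (A - B) (A - B) = frob_inner A (A - B) - frob_inner B (A - B)"
    using assms by (rule frob_inner_diff_left)
  then show ?thesis
    using assms by (simp add: frob_norm_power2 frob_inner_diff_right[of _ n q] frob_inner_commute[of B n q A])
qed

lemma proj_set_eq_singletonI:
  assumes P: "P \<in> S" and less: "\<And>Z. Z \<in> S \<Longrightarrow> Z \<noteq> P \<Longrightarrow> frob_norm (\<Xi> - P) < frob_norm (\<Xi> - Z)"
  shows "proj_set S \<Xi> = {P}"
proof -
  have "frob_norm (\<Xi> - P) \<le> frob_norm (\<Xi> - Z)" if "Z \<in> S" for Z
    using less[OF that] by (cases "Z = P") auto
  then have "dist_set \<Xi> S = ereal (frob_norm (\<Xi> - P))"
    unfolding dist_set_def using P by (intro antisym INF_lower INF_greatest) auto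
  then show ?thesis using P less by (fastforce simp: proj_set_def)
qed

text \<open>Both sides are the trace of \<open>S\<close>, a value that does not depend on
  \<open>Z\<close>.\<close>

lemma stiefel_frob_inner:
  assumes "Z \<in> stiefel n q" "S \<in> carrier_mat q q"
  shows "frob_inner (Z * S) Z = frob_inner S (1\<^sub>m q)"
  using assms frob_inner_mult_left[of Z n q S q Z] by (simp add: stiefel_def)

lemma stiefel_frob_inner_self:
  assumes "Z \<in> stiefel n q"
  shows "frob_inner Z Z = frob_inner (1\<^sub>m q) (1\<^sub>m q)"
  using stiefel_frob_inner[OF assms, of "1\<^sub>m q"] assms by (auto simp: stiefel_def)

text \<open>All orthonormal matrices have the same Frobenius norm, so being nearer to
  \<open>P * S\<close> means having a larger inner product with it. Expanding the positive quantity
  \<open>frob_inner ((P - Z) * S) (P - Z)\<close> leaves twice the gap between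
  \<open>frob_inner (P * S) P\<close> and \<open>frob_inner (P * S) Z\<close>, because the terms in
  \<open>P\<close> alone and in \<open>Z\<close> alone both equal the trace of
  \<open>S\<close>.\<close>

lemma polar_factor_unique_nearest:
  assumes P: "P \<in> stiefel n q" and S: "S \<in> carrier_mat q q" "pos_def S"
    and Z: "Z \<in> stiefel n q" "Z \<noteq> P"
  shows "frob_norm (P * S - P) < frob_norm (P * S - Z)"
proof -
  have Pc: "P \<in> carrier_mat n q" and Zc: "Z \<in> carrier_mat n q" using P Z by (auto simp: stiefel_def)
  have PS: "P * S \<in> carrier_mat n q" and ZS: "Z * S \<in> carrier_mat n q" using Pc Zc S by auto
  have St: "transpose_mat S = S" using S by (simp add: pos_def_def symmetric_mat_def)
  have "P - Z \<noteq> 0\<^sub>m n q" using not_sym[OF Z(2)] Pc Zc by (auto simp: mat_eq_iff)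
  then have "0 < frob_inner ((P - Z) * S) (P - Z)"
    using Pc Zc by (intro pos_def_frob_inner_pos[OF S]) auto
  also have "(P - Z) * S = P * S - Z * S" using Pc Zc S by (intro minus_mult_distrib_mat) auto
  also have "frob_inner (P * S - Z * S) (P - Z) =
      (frob_inner (P * S) P - frob_inner (P * S) Z) - (frob_inner (Z * S) P - frob_inner (Z * S) Z)"
    using PS ZS Pc Zc by (simp add: frob_inner_diff_left[of _ n q] frob_inner_diff_right[of _ n q])
  \<comment> \<open>The two cross terms agree because \<open>S\<close> is symmetric.\<close>
  also have "frob_inner (Z * S) P = frob_inner (P * S) Z"
  proof -
    have "frob_inner (Z * S) P = frob_inner S (transpose_mat Z * P)"
      using Zc S Pc by (intro frob_inner_mult_left) auto
    also have "\<dots> = frob_inner (transpose_mat S) (transpose_mat (transpose_mat Z * P))"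
      using S Zc Pc by (intro frob_inner_transpose[symmetric]) auto
    also have "\<dots> = frob_inner S (transpose_mat P * Z)"
      using Zc Pc by (simp add: St transpose_mult[of _ q n _ q])
    also have "\<dots> = frob_inner (P * S) Z"
      using Zc S Pc by (intro frob_inner_mult_left[symmetric]) auto
    finally show ?thesis .
  qed
  finally have "0 < 2 * (frob_inner (P * S) P - frob_inner (P * S) Z)"
    using stiefel_frob_inner[OF P S(1)] stiefel_frob_inner[OF Z(1) S(1)] by simp
  then show ?thesis
    unfolding frob_norm_less_iff frob_norm_diff_power2[OF PS Pc] frob_norm_diff_power2[OF PS Zc]
      stiefel_frob_inner_self[OF P] stiefel_frob_inner_self[OF Z(1)] by simp
qed

text \<open>Polar decomposition: with \<open>S\<close> the root of the Gram matrix and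
  \<open>R\<close> its inverse, the Gram matrix of \<open>A * R\<close> is
  \<open>transpose_mat R * S * S * R\<close>, in which both ends cancel.\<close>

lemma polar_factor_in_stiefel:
  assumes A: "A \<in> carrier_mat n q" and pd: "pos_def (transpose_mat A * A)"
  obtains S where "S \<in> carrier_mat q q" "pos_def S"
    "mat_inv_sqrt (transpose_mat A * A) \<in> carrier_mat q q"
    "A * mat_inv_sqrt (transpose_mat A * A) \<in> stiefel n q"
    "A = A * mat_inv_sqrt (transpose_mat A * A) * S"
proof -
  have "transpose_mat A * A \<in> carrier_mat q q" using A by simp
  from pos_def_sqrt_exists[OF this pd] obtain S R where S: "S \<in> carrier_mat q q" "pos_def S"
    and R: "R \<in> carrier_mat q q" and SS: "S * S = transpose_mat A * A"
    and SR: "S * R = 1\<^sub>m q" and RS: "R * S = 1\<^sub>m q" by blast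
  have inv: "mat_inv_sqrt (transpose_mat A * A) = R"
    unfolding mat_inv_sqrt_def mat_sqrt_eqI[OF S SS] using mat_inverse_eqI[OF S(1) R SR RS] by simp
  have St: "transpose_mat S = S" using S by (simp add: pos_def_def symmetric_mat_def)
  have RTS: "transpose_mat R * S = 1\<^sub>m q"
    using arg_cong[OF SR, of transpose_mat] S R by (simp add: transpose_mult[of _ q q _ q] St)
  have "transpose_mat (A * R) * (A * R) = transpose_mat R * (transpose_mat A * (A * R))"
    using A R by (simp add: transpose_mult[of _ n q _ q] assoc_mult_mat[of _ q q _ n _ q])
  also have "transpose_mat A * (A * R) = transpose_mat A * A * R"
    using A R by (simp add: assoc_mult_mat[of _ q n _ q _ q])
  also have "\<dots> = S * (S * R)"
    unfolding SS[symmetric] using S R by (simp add: assoc_mult_mat[of _ q q _ q _ q])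
  also have "transpose_mat R * (S * (S * R)) = 1\<^sub>m q" using S R SR RTS by simp
  finally have "A * R \<in> stiefel n q" using A R by (simp add: stiefel_def)
  moreover have "A = A * R * S" using A R S RS by (simp add: assoc_mult_mat[of _ n q _ q _ q])
  ultimately show ?thesis using that S R unfolding inv by blast
qed

section \<open>Injectivity of matrices close to the Stiefel manifold\<close>

lemma scalar_prod_Cauchy_Schwarz:
  assumes v: "(v :: real vec) \<in> carrier_vec n" and w: "w \<in> carrier_vec n"
  shows "(v \<bullet> w)\<^sup>2 \<le> (v \<bullet> v) * (w \<bullet> w)"
proof (cases "w = 0\<^sub>v n")
  case True
  then show ?thesis using v by simp
next
  case False
  then have pos: "0 < w \<bullet> w"
    using scalar_prod_self_nonneg[of w] scalar_prod_self_eq_0_iff[OF w] by linarith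
  \<comment> \<open>A multiple of the component of \<open>v\<close> orthogonal to \<open>w\<close>,
    scaled by \<open>w \<bullet> w\<close> to avoid division.\<close>
  let ?x = "(w \<bullet> w) \<cdot>\<^sub>v v - (v \<bullet> w) \<cdot>\<^sub>v w"
  have wv: "w \<bullet> v = v \<bullet> w" using v w by (simp add: scalar_prod_def mult.commute)
  have "0 \<le> ?x \<bullet> ?x" by (rule scalar_prod_self_nonneg)
  also have "?x \<bullet> ?x = (w \<bullet> w) * ((v \<bullet> v) * (w \<bullet> w) - (v \<bullet> w)\<^sup>2)"
    using v w
    by (simp add: minus_scalar_prod_distrib[of _ n] scalar_prod_minus_distrib[of _ n] wv
        power2_eq_square algebra_simps)
  finally show ?thesis using pos by (simp add: zero_le_mult_iff)
qed

text \<open>The operator norm is at most the Frobenius norm, by Cauchy-Schwarz on each row.\<close>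

lemma mult_mat_vec_frob_bound:
  assumes M: "M \<in> carrier_mat n q" and v: "v \<in> carrier_vec q"
  shows "(M *\<^sub>v v) \<bullet> (M *\<^sub>v v) \<le> (frob_norm M)\<^sup>2 * (v \<bullet> v)"
proof -
  have "(M *\<^sub>v v) \<bullet> (M *\<^sub>v v) = (\<Sum>i<n. (row M i \<bullet> v)\<^sup>2)"
    using M by (simp add: scalar_prod_def[of "M *\<^sub>v v"] atLeast0LessThan power2_eq_square)
  also have "\<dots> \<le> (\<Sum>i<n. (row M i \<bullet> row M i) * (v \<bullet> v))"
    using M v by (intro sum_mono scalar_prod_Cauchy_Schwarz) auto
  also have "\<dots> = (frob_norm M)\<^sup>2 * (v \<bullet> v)"
    using M by (simp add: frob_norm_power2 frob_inner_def sum_distrib_right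
        scalar_prod_def[of "row M _"] atLeast0LessThan)
  finally show ?thesis .
qed

text \<open>Here the radius 1 enters. \<open>Y\<close> preserves lengths, so a nonzero
  \<open>v\<close> with \<open>A *\<^sub>v v = 0\<close> would have the same length as
  \<open>(A - Y) *\<^sub>v v\<close>, which is strictly shorter than \<open>v\<close> when
  \<open>A - Y\<close> has norm below 1.\<close>

lemma pos_def_gram_near_stiefel:
  assumes A: "A \<in> carrier_mat n q" and Y: "Y \<in> stiefel n q" and less: "frob_norm (A - Y) < 1"
  shows "pos_def (transpose_mat A * A)"
  unfolding pos_def_def symmetric_mat_def
proof (intro conjI ballI impI)
  show "transpose_mat (transpose_mat A * A) = transpose_mat A * A"
    using A by (simp add: transpose_mult[of _ q n _ q])
  fix v :: "real vec"
  assume "v \<in> carrier_vec (dim_row (transpose_mat A * A))" "v \<noteq> 0\<^sub>v (dim_row (transpose_mat A * A))"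
  then have v: "v \<in> carrier_vec q" and v0: "v \<noteq> 0\<^sub>v q" using A by auto
  have Yc: "Y \<in> carrier_mat n q" and YY: "transpose_mat Y * Y = 1\<^sub>m q" using Y by (auto simp: stiefel_def)
  have gram: "v \<bullet> (transpose_mat B * B *\<^sub>v v) = (B *\<^sub>v v) \<bullet> (B *\<^sub>v v)"
    if B: "B \<in> carrier_mat n q" for B
    using B v scalar_prod_mult_mat_vec_transpose[of "transpose_mat B" q n v "B *\<^sub>v v"]
    by (simp add: assoc_mult_mat_vec[of _ q n _ q])
  have vv: "0 < v \<bullet> v"
    using scalar_prod_self_nonneg[of v] scalar_prod_self_eq_0_iff[OF v] v0 by linarith
  have "(A *\<^sub>v v) \<bullet> (A *\<^sub>v v) \<noteq> 0"
  proof
    assume "(A *\<^sub>v v) \<bullet> (A *\<^sub>v v) = 0"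
    then have "A *\<^sub>v v = 0\<^sub>v n" using A v by (subst (asm) scalar_prod_self_eq_0_iff[of _ n]) auto
    then have "(A - Y) *\<^sub>v v = - (Y *\<^sub>v v)"
      using A Yc v by (simp add: minus_mult_distrib_mat_vec[of _ n q])
    then have "v \<bullet> v = ((A - Y) *\<^sub>v v) \<bullet> ((A - Y) *\<^sub>v v)"
      using gram[OF Yc] Yc v by (simp add: YY)
    also have "\<dots> \<le> (frob_norm (A - Y))\<^sup>2 * (v \<bullet> v)"
      using A Yc v by (intro mult_mat_vec_frob_bound) auto
    also have "\<dots> < 1 * (v \<bullet> v)"
      using less frob_norm_nonneg[of "A - Y"] vv
      by (intro mult_strict_right_mono) (auto simp: power_less_one_iff abs_square_less_1)
    finally show False by simp
  qed
  then show "0 < v \<bullet> (transpose_mat A * A *\<^sub>v v)"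
    unfolding gram[OF A] using scalar_prod_self_nonneg[of "A *\<^sub>v v"] by linarith
qed

section \<open>Nearest points within the range of an orthogonal projector\<close>

text \<open>\<open>A - Q * A\<close> is orthogonal to the range of \<open>Q\<close>, which contains
  \<open>Q * A - Z\<close>. In the proof this appears as two inner products in which
  \<open>Q\<close> is absorbed by \<open>Z\<close> and by \<open>Q * A\<close>.\<close>

lemma frob_pythagoras:
  assumes Q: "Q \<in> carrier_mat n n" "transpose_mat Q = Q" "Q * Q = Q"
    and A: "A \<in> carrier_mat n q" and Z: "Z \<in> carrier_mat n q" "Q * Z = Z"
  shows "(frob_norm (A - Z))\<^sup>2 = (frob_norm (Q * A - Z))\<^sup>2 + (frob_norm (A - Q * A))\<^sup>2"
proof -
  have QA: "Q * A \<in> carrier_mat n q" using Q A by simp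
  have QQA: "Q * (Q * A) = Q * A"
    using Q A by (metis assoc_mult_mat)
  have "frob_inner (Q * A) Z = frob_inner A Z"
    using frob_inner_mult_left[OF Q(1) A Z(1)] Q Z by simp
  moreover have "frob_inner (Q * A) (Q * A) = frob_inner A (Q * A)"
    using frob_inner_mult_left[OF Q(1) A QA] Q QQA by simp
  ultimately show ?thesis
    using frob_norm_diff_power2[OF A Z(1)] frob_norm_diff_power2[OF QA Z(1)]
      frob_norm_diff_power2[OF A QA] by simp
qed

lemma proj_stiefel_range:
  assumes Q: "Q \<in> carrier_mat n n" "transpose_mat Q = Q" "Q * Q = Q"
    and A: "A \<in> carrier_mat n q" and dist: "dist_set A {Y \<in> stiefel n q. Q * Y = Y} < 1"
  defines "G \<equiv> transpose_mat A * Q * A"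
  shows "pos_def G"
    and "proj_set (stiefel n q) (Q * A) = {Q * A * mat_inv_sqrt G}"
    and "proj_set {Y \<in> stiefel n q. Q * Y = Y} A = {Q * A * mat_inv_sqrt G}"
proof -
  have QA: "Q * A \<in> carrier_mat n q" using Q A by simp
  \<comment> \<open>As \<open>Q\<close> is symmetric and idempotent, \<open>G\<close> is the Gram
    matrix of \<open>Q * A\<close>, so the polar decomposition applies to it.\<close>
  have G: "G = transpose_mat (Q * A) * (Q * A)"
  proof -
    have "transpose_mat (Q * A) * (Q * A) = transpose_mat A * (Q * (Q * A))"
      using Q A by (simp add: transpose_mult[of _ n n _ q] assoc_mult_mat[of _ q n _ n _ q])
    also have "Q * (Q * A) = Q * A" using Q A by (metis assoc_mult_mat)
    finally show ?thesis unfolding G_def using Q A by (simp add: assoc_mult_mat[of _ q n _ n _ q])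
  qed
  \<comment> \<open>A strict bound on the infimum supplies an actual point before any minimiser is
    known; by Pythagoras it is at least as close to \<open>Q * A\<close> as to
    \<open>A\<close>.\<close>
  from dist obtain Y where Y: "Y \<in> stiefel n q" "Q * Y = Y" and "frob_norm (A - Y) < 1"
    unfolding dist_set_def INF_less_iff by (auto simp: one_ereal_def)
  then have "(frob_norm (A - Y))\<^sup>2 < 1"
    using frob_norm_nonneg[of "A - Y"] by (auto simp: abs_square_less_1)
  moreover have "Y \<in> carrier_mat n q" using Y by (simp add: stiefel_def)
  ultimately have "(frob_norm (Q * A - Y))\<^sup>2 < 1"
    using frob_pythagoras[OF Q A _ Y(2)] zero_le_power2[of "frob_norm (A - Q * A)"] by linarith
  then have "frob_norm (Q * A - Y) < 1" by (simp add: abs_square_less_1)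
  from pos_def_gram_near_stiefel[OF QA Y(1) this] show pd: "pos_def G" unfolding G .
  define P where "P = Q * A * mat_inv_sqrt G"
  obtain S where S: "S \<in> carrier_mat q q" "pos_def S" and R: "mat_inv_sqrt G \<in> carrier_mat q q"
    and P: "P \<in> stiefel n q" and QAP: "Q * A = P * S"
    using polar_factor_in_stiefel[OF QA pd[unfolded G]] unfolding P_def G by metis
  \<comment> \<open>The nearest point of the whole Stiefel manifold to \<open>Q * A\<close> already
    lies in the range of \<open>Q\<close>, hence in the smaller set.\<close>
  have QP: "Q * P = P"
  proof -
    have "Q * P = Q * (Q * A) * mat_inv_sqrt G"
      unfolding P_def using Q QA R by (intro assoc_mult_mat[symmetric]) auto
    also have "Q * (Q * A) = Q * A" using Q A by (metis assoc_mult_mat)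
    finally show ?thesis by (simp add: P_def)
  qed
  have less: "frob_norm (Q * A - P) < frob_norm (Q * A - Z)" if "Z \<in> stiefel n q" "Z \<noteq> P" for Z
    using polar_factor_unique_nearest[OF P S that] by (simp add: QAP)
  then show "proj_set (stiefel n q) (Q * A) = {Q * A * mat_inv_sqrt G}"
    unfolding P_def[symmetric] by (intro proj_set_eq_singletonI P)
  show "proj_set {Y \<in> stiefel n q. Q * Y = Y} A = {Q * A * mat_inv_sqrt G}"
    unfolding P_def[symmetric]
  proof (rule proj_set_eq_singletonI)
    fix Z assume "Z \<in> {Y \<in> stiefel n q. Q * Y = Y}" "Z \<noteq> P"
    then have Z: "Z \<in> stiefel n q" "Q * Z = Z" "Z \<noteq> P" by auto
    have "P \<in> carrier_mat n q" "Z \<in> carrier_mat n q" using P Z by (auto simp: stiefel_def)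
    \<comment> \<open>For \<open>P\<close> and \<open>Z\<close> alike, passing from
      \<open>Q * A\<close> to \<open>A\<close> adds the same term to the squared distance.\<close>
    then show "frob_norm (A - P) < frob_norm (A - Z)"
      using less[OF Z(1,3)] frob_pythagoras[OF Q A _ QP] frob_pythagoras[OF Q A _ Z(2)]
      by (simp add: frob_norm_less_iff)
  qed (use P QP in simp)
qed

section \<open>Closedness under Frobenius limits\<close>

lemma abs_index_le_frob_norm:
  assumes "i < dim_row A" "j < dim_col A"
  shows "\<bar>A $$ (i, j)\<bar> \<le> frob_norm A"
proof -
  have "(A $$ (i, j))\<^sup>2 \<le> (\<Sum>j<dim_col A. (A $$ (i, j))\<^sup>2)"
    using assms by (intro member_le_sum) auto
  also have "\<dots> \<le> (\<Sum>i<dim_row A. \<Sum>j<dim_col A. (A $$ (i, j))\<^sup>2)"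
    using assms by (intro member_le_sum[of i _ "\<lambda>i. \<Sum>j<dim_col A. (A $$ (i, j))\<^sup>2"]) (auto intro: sum_nonneg)
  finally show ?thesis unfolding frob_norm_def by (rule real_le_rsqrt[of "\<bar>_\<bar>", simplified])
qed

lemma tendsto_index_of_frob_norm:
  assumes "\<And>k. Y k \<in> carrier_mat n q" "A \<in> carrier_mat n q"
    and lim: "(\<lambda>k. frob_norm (Y k - A)) \<longlonglongrightarrow> 0" and ij: "i < n" "j < q"
  shows "(\<lambda>k. Y k $$ (i, j)) \<longlonglongrightarrow> A $$ (i, j)"
proof -
  have "norm (Y k $$ (i, j) - A $$ (i, j)) \<le> frob_norm (Y k - A)" for k
    using abs_index_le_frob_norm[of i "Y k - A" j] assms(1)[of k] assms(2) ij by simp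
  then have "(\<lambda>k. Y k $$ (i, j) - A $$ (i, j)) \<longlonglongrightarrow> 0"
    by (intro tendsto_0_le[OF lim, of _ 1]) (simp add: frob_norm_nonneg)
  then show ?thesis by (rule LIM_zero_cancel)
qed

lemma tendsto_mult_mat_index:
  fixes A B :: "real mat"
  assumes X: "\<And>k. X k \<in> carrier_mat n m" "A \<in> carrier_mat n m"
    and Y: "\<And>k. Y k \<in> carrier_mat m q" "B \<in> carrier_mat m q"
    and limX: "\<And>i j. i < n \<Longrightarrow> j < m \<Longrightarrow> (\<lambda>k. X k $$ (i, j)) \<longlonglongrightarrow> A $$ (i, j)"
    and limY: "\<And>i j. i < m \<Longrightarrow> j < q \<Longrightarrow> (\<lambda>k. Y k $$ (i, j)) \<longlonglongrightarrow> B $$ (i, j)"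
    and ij: "i < n" "j < q"
  shows "(\<lambda>k. (X k * Y k) $$ (i, j)) \<longlonglongrightarrow> (A * B) $$ (i, j)"
proof -
  have eq: "(M * N) $$ (i, j) = (\<Sum>l<m. M $$ (i, l) * N $$ (l, j))"
    if "M \<in> carrier_mat n m" "N \<in> carrier_mat m q" for M N :: "real mat"
    using that ij by (simp add: scalar_prod_def atLeast0LessThan)
  show ?thesis
    unfolding eq[OF X(1) Y(1)] eq[OF X(2) Y(2)]
    using ij by (intro tendsto_sum tendsto_mult limX limY) auto
qed

text \<open>Both defining equations are polynomial in the entries of \<open>Y\<close>, and Frobenius
  convergence implies entrywise convergence, so they pass to the limit.\<close>

lemma closed_mats_stiefel_range:
  assumes Q: "Q \<in> carrier_mat n n"
  shows "closed_mats n q {Y \<in> stiefel n q. Q * Y = Y}"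
  unfolding closed_mats_def
proof (intro conjI allI impI)
  show "{Y \<in> stiefel n q. Q * Y = Y} \<subseteq> carrier_mat n q" by (auto simp: stiefel_def)
  fix Y A
  assume "\<forall>k::nat. Y k \<in> {Y \<in> stiefel n q. Q * Y = Y}" and A: "A \<in> carrier_mat n q"
    and lim: "(\<lambda>k. frob_norm (Y k - A)) \<longlonglongrightarrow> 0"
  then have Y: "Y k \<in> carrier_mat n q" "transpose_mat (Y k) * Y k = 1\<^sub>m q" "Q * Y k = Y k" for k
    by (auto simp: stiefel_def)
  note ent = tendsto_index_of_frob_norm[OF Y(1) A lim]
  have T: "(\<lambda>k. transpose_mat (Y k) $$ (i, j)) \<longlonglongrightarrow> transpose_mat A $$ (i, j)" if "i < q" "j < n" for i j
    using ent[OF that(2,1)] that A carrier_matD[OF Y(1)] by simp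
  have "transpose_mat A * A = 1\<^sub>m q"
  proof (rule eq_matI)
    fix i j assume "i < dim_row (1\<^sub>m q)" "j < dim_col (1\<^sub>m q)"
    then have ij: "i < q" "j < q" by auto
    have "(\<lambda>k. (transpose_mat (Y k) * Y k) $$ (i, j)) \<longlonglongrightarrow> (transpose_mat A * A) $$ (i, j)"
      by (rule tendsto_mult_mat_index[of _ q n _ _ q]) (use Y A T ent ij in auto)
    then show "(transpose_mat A * A) $$ (i, j) = 1\<^sub>m q $$ (i, j)"
      unfolding Y(2) by (rule LIMSEQ_unique[OF _ tendsto_const])
  qed (use A in auto)
  moreover have "Q * A = A"
  proof (rule eq_matI)
    fix i j assume "i < dim_row A" "j < dim_col A"
    then have ij: "i < n" "j < q" using A by auto
    have "(\<lambda>k. (Q * Y k) $$ (i, j)) \<longlonglongrightarrow> (Q * A) $$ (i, j)"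
      by (rule tendsto_mult_mat_index[of _ n n _ _ q]) (use Y A Q ent ij in auto)
    then show "(Q * A) $$ (i, j) = A $$ (i, j)"
      unfolding Y(3) using ent[OF ij] by (rule LIMSEQ_unique)
  qed (use A Q in auto)
  ultimately show "A \<in> {Y \<in> stiefel n q. Q * Y = Y}" using A by (simp add: stiefel_def)
qed

section \<open>Submatrices of columns, and the block as the fixed points of a projector\<close>

text \<open>\<open>pick D\<close> enumerates \<open>D\<close> increasingly, so the Gram matrix of
  the chosen columns consists of the entries of \<open>transpose_mat X * X\<close> at picked
  indices; injectivity of \<open>pick D\<close> turns these into an identity matrix.\<close>

lemma sub_cols_in_stiefel:
  assumes X: "X \<in> stiefel n p" and D: "D \<subseteq> {..<p}"
  shows "sub_cols X D \<in> stiefel n (card D)"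
proof -
  have Xc: "X \<in> carrier_mat n p" and XX: "transpose_mat X * X = 1\<^sub>m p" using X by (auto simp: stiefel_def)
  \<comment> \<open>\<open>submatrix\<close> counts only indices within range; \<open>D\<close> has
    no others.\<close>
  have cD: "{j. j < p \<and> j \<in> D} = D" using D by auto
  have U: "sub_cols X D \<in> carrier_mat n (card D)"
    using Xc by (intro carrier_matI) (simp_all add: dim_submatrix cD)
  have ind: "sub_cols X D $$ (r, i) = X $$ (r, pick D i)" if "r < n" "i < card D" for r i
    using that Xc by (subst submatrix_index) (auto simp: cD pick_UNIV)
  have pk: "pick D i < p" if "i < card D" for i
    using that D by (meson pick_in_set_le lessThan_iff subsetD)
  have pick_inj: "pick D i = pick D j \<longleftrightarrow> i = j" if "i < card D" "j < card D" for i j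
    using that by (metis nat_neq_iff pick_mono_le)
  have "transpose_mat (sub_cols X D) * sub_cols X D = 1\<^sub>m (card D)"
  proof (rule eq_matI)
    fix i j assume "i < dim_row (1\<^sub>m (card D))" "j < dim_col (1\<^sub>m (card D))"
    then have ij: "i < card D" "j < card D" by auto
    have "(transpose_mat (sub_cols X D) * sub_cols X D) $$ (i, j) =
        (\<Sum>r<n. X $$ (r, pick D i) * X $$ (r, pick D j))"
      using U ij by (simp add: scalar_prod_def atLeast0LessThan ind)
    also have "\<dots> = (transpose_mat X * X) $$ (pick D i, pick D j)"
      using Xc pk[OF ij(1)] pk[OF ij(2)] by (simp add: scalar_prod_def atLeast0LessThan)
    also have "\<dots> = 1\<^sub>m (card D) $$ (i, j)"
      unfolding XX using pk ij pick_inj by simp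
    finally show "(transpose_mat (sub_cols X D) * sub_cols X D) $$ (i, j) = 1\<^sub>m (card D) $$ (i, j)" .
  qed (use U in auto)
  with U show ?thesis by (simp add: stiefel_def)
qed

text \<open>Everything follows from \<open>Q * A = A - U * (transpose_mat U * A)\<close> and
  \<open>transpose_mat U * Q = 0\<^sub>m k n\<close>, the latter by orthonormality of the columns of
  \<open>U\<close>.\<close>

lemma orthogonal_complement_projector:
  assumes U: "U \<in> stiefel n k"
  defines "Q \<equiv> 1\<^sub>m n - U * transpose_mat U"
  shows "Q \<in> carrier_mat n n" "transpose_mat Q = Q" "Q * Q = Q"
    and "A \<in> carrier_mat n q \<Longrightarrow> transpose_mat U * A = 0\<^sub>m k q \<longleftrightarrow> Q * A = A"
proof -
  have Uc: "U \<in> carrier_mat n k" and UU: "transpose_mat U * U = 1\<^sub>m k" using U by (auto simp: stiefel_def)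
  have UT: "U * transpose_mat U \<in> carrier_mat n n" using Uc by simp
  show Q: "Q \<in> carrier_mat n n" unfolding Q_def using UT by (rule minus_carrier_mat)
  show "transpose_mat Q = Q"
    unfolding Q_def using Uc by (simp add: transpose_minus[of _ n n] transpose_mult[of _ n k _ n])
  have QA: "Q * A = A - U * (transpose_mat U * A)" if "A \<in> carrier_mat n m" for A m
    unfolding Q_def using that Uc UT
    by (simp add: minus_mult_distrib_mat[of _ n n _ _ m] assoc_mult_mat[of _ n k _ n _ m])
  have UQ: "transpose_mat U * Q = 0\<^sub>m k n"
  proof -
    have "transpose_mat U * Q = transpose_mat U - transpose_mat U * (U * transpose_mat U)"
      unfolding Q_def using Uc by (simp add: mult_minus_distrib_mat[of _ k n _ n])
    also have "transpose_mat U * (U * transpose_mat U) = transpose_mat U"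
      using Uc UU by (simp flip: assoc_mult_mat[of _ k n _ k _ n])
    finally show ?thesis using Uc by (auto simp: mat_eq_iff)
  qed
  show "Q * Q = Q"
    unfolding QA[OF Q] UQ using Uc Q by (intro eq_matI) auto
  show "transpose_mat U * A = 0\<^sub>m k q \<longleftrightarrow> Q * A = A" if A: "A \<in> carrier_mat n q"
  proof
    assume "transpose_mat U * A = 0\<^sub>m k q"
    then show "Q * A = A" unfolding QA[OF A] using Uc A by (intro eq_matI) auto
  next
    assume "Q * A = A"
    then have "transpose_mat U * A = transpose_mat U * Q * A"
      using Uc Q A by (simp add: assoc_mult_mat[of _ k n _ n _ q])
    then show "transpose_mat U * A = 0\<^sub>m k q" unfolding UQ using A by simp
  qed
qed

theorem lemma3p2:
  fixes n p :: nat and C :: "nat set" and X :: "real mat"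
  assumes "p \<le> n" and "1 \<le> p"
    and "C \<subseteq> {..<p}" and "X \<in> stiefel n p"
  shows "proximally_smooth n (card C) 1 (submanifold_block n p X C) \<and>
    (\<forall>\<Xi>\<in>carrier_mat n (card C).
      dist_set \<Xi> (submanifold_block n p X C) < 1 \<longrightarrow>
      (let U = sub_cols X ({..<p} - C);
           Q = 1\<^sub>m n - U * transpose_mat U;
           G = transpose_mat \<Xi> * Q * \<Xi>
       in proj_set (submanifold_block n p X C) \<Xi> = proj_set (stiefel n (card C)) (Q * \<Xi>) \<and>
          pos_def G \<and>
          proj_set (stiefel n (card C)) (Q * \<Xi>) = {Q * \<Xi> * mat_inv_sqrt G} \<and>
          (transpose_mat U * \<Xi> = 0\<^sub>m (card ({..<p} - C)) (card C) \<longrightarrow>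
            proj_set (submanifold_block n p X C) \<Xi> = proj_set (stiefel n (card C)) \<Xi>)))"
proof -
  define U where "U = sub_cols X ({..<p} - C)"
  define Q where "Q = 1\<^sub>m n - U * transpose_mat U"
  let ?k = "card ({..<p} - C)" and ?q = "card C"
  have U: "U \<in> stiefel n ?k"
    unfolding U_def using assms by (intro sub_cols_in_stiefel) auto
  note Q = orthogonal_complement_projector(1-3)[OF U, folded Q_def]
  note ker = orthogonal_complement_projector(4)[OF U, folded Q_def]
  \<comment> \<open>The orthogonality constraint becomes a fixed-point equation, the form to which
    the results on projectors apply.\<close>
  have block: "submanifold_block n p X C = {Y \<in> stiefel n ?q. Q * Y = Y}"
    unfolding submanifold_block_def U_def[symmetric] using ker by (auto simp: stiefel_def)
  note proj = proj_stiefel_range[OF Q, of _ ?q, folded block]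
  have "proximally_smooth n ?q 1 (submanifold_block n p X C)"
    unfolding proximally_smooth_def
    using closed_mats_stiefel_range[OF Q(1), of ?q, folded block] proj(3)
    by (auto simp: one_ereal_def)
  moreover have "proj_set (submanifold_block n p X C) \<Xi> = proj_set (stiefel n ?q) (Q * \<Xi>) \<and>
      pos_def (transpose_mat \<Xi> * Q * \<Xi>) \<and>
      proj_set (stiefel n ?q) (Q * \<Xi>) = {Q * \<Xi> * mat_inv_sqrt (transpose_mat \<Xi> * Q * \<Xi>)} \<and>
      (transpose_mat U * \<Xi> = 0\<^sub>m ?k ?q \<longrightarrow>
        proj_set (submanifold_block n p X C) \<Xi> = proj_set (stiefel n ?q) \<Xi>)"
    if "\<Xi> \<in> carrier_mat n ?q" "dist_set \<Xi> (submanifold_block n p X C) < 1" for \<Xi>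
    \<comment> \<open>For the last claim, \<open>ker\<close> turns
      \<open>transpose_mat U * \<Xi> = 0\<^sub>m ?k ?q\<close> into
      \<open>Q * \<Xi> = \<Xi>\<close>.\<close>
    using proj[OF that] ker[OF that(1)] by metis
  ultimately show ?thesis
    unfolding Let_def U_def[symmetric] Q_def[symmetric] by blast
qed

end
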